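(* Let $X$ be a polyhedron in $\mathbb{R}^n$, let $f:X\to X$ be a simplicial map, and let $k\in\{0,1,\dots,n\}$. If $v_k(f,X)\neq 0$, where $v_k$ is the $k$-dimensional Lefschetz volume, then $f$ has a fixed point in a simplex of $X$ with dimension at least $k$.
   Context: A polyhedron in $\mathbb{R}^n$ is a geometric realization in $\mathbb{R}^n$ of a finite simplicial complex; it always comes with its simplicial decomposition. A simplicial map sends vertices to vertices, is affine on each simplex, and takes simplices to simplices. For a closed simplex $x$ of $X$: $c(f,x)=0$ if $f(x)\neq x$; $c(f,x)=1$ if $f(x)=x$ and $f$ preserves the orientation of $x$; $c(f,x)=-1$ if $f(x)=x$ and $f$ reverses the orientation of $x$. (When $f(x)=x$, this is the sign of the permutation of the vertices of $x$ induced by $f$.) The intrinsic volumes $\mu_0,\dots,\mu_n$ are determined on nonempty compact convex $A\subset\mathbb{R}^n$ by the Steiner formula $\mathrm{Vol}(\{y\in\mathbb{R}^n: d(y,A)\le\rho\})=\sum_{k=0}^n\rho^{n-k}\omega_{n-k}\mu_k(A)$ for $\rho>0$, where $\omega_j$ is the volume of the $j$-dimensional unit ball. The $k$-dimensional Lefschetz volume is $v_k(f,X)=\sum_{x\subseteq X}(-1)^{\dim(x)-k}c(f,x)\mu_k(x)$, the sum being over all nonempty closed simplices $x$ of $X$, of all dimensions. *)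

theory Defs
  imports "HOL-Analysis.Analysis" "HOL-Combinatorics.Permutations"
begin

text \<open>
  A polyhedron in the sense of a geometric simplicial complex is represented by its finite set of
  closed simplices \<open>C\<close>, with \<^const>\<open>simplicial_complex\<close> from the library (the library constant
  \<^const>\<open>polyhedron\<close>, a finite intersection of half-spaces, is a different notion); the underlying
  space is \<open>\<Union>C\<close>. Note that \<^const>\<open>simplicial_complex\<close> is closed under \<^emph>\<open>all\<close> faces, so
  a nonempty complex also contains the empty simplex, of dimension \<open>-1\<close>. Self-maps of the underlying
  space are total functions whose values off \<open>\<Union>C\<close> are irrelevant.
\<close>

definition affine_map_on :: "'a::real_vector set \<Rightarrow> ('a \<Rightarrow> 'b::real_vector) \<Rightarrow> bool" where
  "affine_map_on S f \<longleftrightarrow>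
     (\<forall>x\<in>S. \<forall>y\<in>S. \<forall>u\<in>{0..1::real}.
        f ((1 - u) *\<^sub>R x + u *\<^sub>R y) = (1 - u) *\<^sub>R f x + u *\<^sub>R f y)"

definition simplicial_map ::
    "'a::euclidean_space set set \<Rightarrow> 'b::euclidean_space set set \<Rightarrow> ('a \<Rightarrow> 'b) \<Rightarrow> bool" where
  "simplicial_map C D f \<longleftrightarrow>
     (\<forall>v. {v} \<in> C \<longrightarrow> {f v} \<in> D) \<and>
     (\<forall>x\<in>C. affine_map_on x f) \<and>
     (\<forall>x\<in>C. f ` x \<in> D)"

lemma simplicial_map_funcset: "simplicial_map C D f \<Longrightarrow> f \<in> \<Union>C \<rightarrow> \<Union>D"
  by (auto simp: simplicial_map_def)

text \<open>
  The vertices of a simplex are its extreme points. If \<open>f\<close> is affine on \<open>x\<close> and \<open>f ` x = x\<close>, then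
  \<open>f\<close> permutes them; \<^const>\<open>sign_on\<close> extends this permutation by the identity and takes its sign.
\<close>

definition orientation_coeff :: "('a::euclidean_space \<Rightarrow> 'a) \<Rightarrow> 'a set \<Rightarrow> int" where
  "orientation_coeff f x = (if f ` x = x then sign_on {v. v extreme_point_of x} f else 0)"

definition steiner_coeffs :: "'a::euclidean_space set \<Rightarrow> (nat \<Rightarrow> real) \<Rightarrow> bool" where
  "steiner_coeffs A \<mu> \<longleftrightarrow>
     (\<forall>\<rho>>0. measure lebesgue {y. infdist y A \<le> \<rho>} =
        (\<Sum>k\<le>DIM('a). \<rho> ^ (DIM('a) - k) * unit_ball_vol (real (DIM('a) - k)) * \<mu> k))"

text \<open>
  By Steiner's theorem the condition below holds for every nonempty compact convex \<open>A\<close>; sets without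
  a Steiner formula get the value \<open>0\<close>. The coefficients with index at most \<open>DIM('a)\<close> are unique (see
  \<open>intrinsic_volume_eq\<close>); larger indices have no meaning.
\<close>

definition intrinsic_volume :: "nat \<Rightarrow> 'a::euclidean_space set \<Rightarrow> real" where
  "intrinsic_volume k A =
     (if \<exists>\<mu>. steiner_coeffs A \<mu> then (SOME \<mu>. steiner_coeffs A \<mu>) k else 0)"

lemma steiner_coeffs_unique:
  fixes A :: "'a::euclidean_space set"
  assumes "steiner_coeffs A \<mu>" "steiner_coeffs A \<nu>" "k \<le> DIM('a)"
  shows "\<mu> k = \<nu> k"
proof -
  let ?n = "DIM('a)"
  define c where "c i = unit_ball_vol (real i) * (\<mu> (?n - i) - \<nu> (?n - i))" for i
  have "(\<Sum>i\<le>?n. c i * \<rho> ^ i) = 0" if "\<rho> > 0" for \<rho> :: real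
  proof -
    have "(\<Sum>i\<le>?n. c i * \<rho> ^ i) = (\<Sum>k\<le>?n. c (?n - k) * \<rho> ^ (?n - k))"
      by (rule sum.reindex_bij_witness[of _ "\<lambda>k. ?n - k" "\<lambda>k. ?n - k"]) auto
    also have "\<dots> = (\<Sum>k\<le>?n. \<rho> ^ (?n - k) * unit_ball_vol (real (?n - k)) * \<mu> k) -
                    (\<Sum>k\<le>?n. \<rho> ^ (?n - k) * unit_ball_vol (real (?n - k)) * \<nu> k)"
      unfolding sum_subtractf[symmetric] by (rule sum.cong) (auto simp: c_def algebra_simps)
    also have "\<dots> = 0"
    proof -
      have "measure lebesgue {y. infdist y A \<le> \<rho>} =
          (\<Sum>k\<le>?n. \<rho> ^ (?n - k) * unit_ball_vol (real (?n - k)) * \<mu> k)"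
        using assms(1)[unfolded steiner_coeffs_def, rule_format, OF that] .
      moreover have "measure lebesgue {y. infdist y A \<le> \<rho>} =
          (\<Sum>k\<le>?n. \<rho> ^ (?n - k) * unit_ball_vol (real (?n - k)) * \<nu> k)"
        using assms(2)[unfolded steiner_coeffs_def, rule_format, OF that] .
      ultimately show ?thesis
        by (simp only: diff_self)
    qed
    finally show ?thesis .
  qed
  then have "{0<..} \<subseteq> {\<rho>::real. (\<Sum>i\<le>?n. c i * \<rho> ^ i) = 0}"
    by auto
  then have "infinite {\<rho>::real. (\<Sum>i\<le>?n. c i * \<rho> ^ i) = 0}"
    by (meson infinite_Ioi finite_subset)
  then have "c (?n - k) = 0"
    unfolding polyfun_finite_roots by simp
  moreover have "unit_ball_vol (real (?n - k)) \<noteq> 0"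
    using unit_ball_vol_pos[of "real (?n - k)"] by linarith
  ultimately show ?thesis
    using assms(3) unfolding c_def mult_eq_0_iff by simp
qed

lemma intrinsic_volume_eq:
  fixes A :: "'a::euclidean_space set"
  assumes "steiner_coeffs A \<mu>" "k \<le> DIM('a)"
  shows "intrinsic_volume k A = \<mu> k"
proof -
  have "(SOME \<mu>. steiner_coeffs A \<mu>) k = \<mu> k"
    using someI[of "steiner_coeffs A", OF assms(1)] assms by (rule steiner_coeffs_unique)
  moreover have "\<exists>\<mu>. steiner_coeffs A \<mu>"
    using assms(1) by (rule exI[of _ \<mu>])
  ultimately show ?thesis
    unfolding intrinsic_volume_def by (simp only: if_True)
qed

definition lefschetz_volume ::
    "nat \<Rightarrow> ('a::euclidean_space \<Rightarrow> 'a) \<Rightarrow> 'a set set \<Rightarrow> real" where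
  "lefschetz_volume k f C =
     (\<Sum>x\<in>C - {{}}. (- 1) powi (aff_dim x - int k) * of_int (orientation_coeff f x) *
        intrinsic_volume k x)"

end

theory Submission
  imports Defs
begin

text \<open>
  A nonzero Lefschetz volume has a nonzero summand, that is, a simplex \<open>x\<close> with \<open>f ` x = x\<close> and
  nonzero \<open>k\<close>-th intrinsic volume. Two facts about this single simplex give the theorem.

  Since \<open>f\<close> is affine on \<open>x\<close> and maps \<open>x\<close> onto itself, it permutes the vertices of \<open>x\<close> and hence
  fixes their barycentre (\<open>affine_self_map_polytope_fixed_point\<close>).

  An intrinsic volume whose index exceeds the dimension vanishes
  (\<open>intrinsic_volume_eq_0_above_dim\<close>), so \<open>aff_dim x \<ge> k\<close>. If \<open>x\<close> has no Steiner formula, its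
  intrinsic volumes are \<open>0\<close> by definition;
  otherwise the volume of the \<open>\<rho>\<close>-neighbourhood of \<open>x\<close> is a polynomial in \<open>\<rho>\<close> in which the \<open>k\<close>-th
  intrinsic volume is, up to a nonzero factor, the coefficient of \<open>\<rho> ^ (n - k)\<close>. A simplex of dimension
  \<open>d\<close> is covered by at most \<open>(N + 1) ^ d\<close> balls of radius proportional to \<open>1 / N\<close>, so its
  \<open>1 / N\<close>-neighbourhood has volume at most a constant times \<open>(1 / N) ^ (n - d)\<close>
  (\<open>measure_neighbourhood_convex_hull_le\<close>). Letting \<open>N\<close> grow kills every coefficient of degree below
  \<open>n - d\<close>, in particular that of degree \<open>n - k\<close> when \<open>k > d\<close>.
\<close>

section \<open>Fixed points of affine self-maps of polytopes\<close>

text \<open>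
  For every vector \<open>b\<close>, both \<open>\<lambda>y. b \<bullet> f y\<close> and its negative are convex on \<open>S\<close>, so Jensen's inequality
  holds in both directions.
\<close>

lemma affine_map_on_convex_combination:
  fixes f :: "'a::real_vector \<Rightarrow> 'b::real_inner"
  assumes f: "affine_map_on S f" and "convex S" "finite I"
    and u: "\<And>i. i \<in> I \<Longrightarrow> 0 \<le> u i" "sum u I = 1"
    and x: "\<And>i. i \<in> I \<Longrightarrow> x i \<in> S"
  shows "f (\<Sum>i\<in>I. u i *\<^sub>R x i) = (\<Sum>i\<in>I. u i *\<^sub>R f (x i))"
proof (rule vector_eq_ldot[THEN iffD1], intro allI)
  fix b :: 'b
  have "I \<noteq> {}"
    using u(2) by auto
  have *: "c * (b \<bullet> f (\<Sum>i\<in>I. u i *\<^sub>R x i)) \<le> (\<Sum>i\<in>I. u i * (c * (b \<bullet> f (x i))))" for c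
  proof (rule convex_on_sum[of I S "\<lambda>y. c * (b \<bullet> f y)"])
    show "convex_on S (\<lambda>y. c * (b \<bullet> f y))"
    proof (rule convex_onI)
      fix t :: real and y z
      assume "0 < t" "t < 1" "y \<in> S" "z \<in> S"
      then have "f ((1 - t) *\<^sub>R y + t *\<^sub>R z) = (1 - t) *\<^sub>R f y + t *\<^sub>R f z"
        using f by (simp add: affine_map_on_def)
      then show "c * (b \<bullet> f ((1 - t) *\<^sub>R y + t *\<^sub>R z))
          \<le> (1 - t) * (c * (b \<bullet> f y)) + t * (c * (b \<bullet> f z))"
        by (simp add: inner_add_right distrib_left mult.left_commute)
    qed (fact \<open>convex S\<close>)
  qed (use assms \<open>I \<noteq> {}\<close> in auto)
  show "b \<bullet> f (\<Sum>i\<in>I. u i *\<^sub>R x i) = b \<bullet> (\<Sum>i\<in>I. u i *\<^sub>R f (x i))"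
    using *[of 1] *[of "-1"] by (simp add: inner_sum_right sum_negf)
qed

text \<open>
  An extreme point of \<open>f ` S = convex hull (f ` V)\<close> must lie in \<open>f ` V\<close>, where \<open>V\<close> is the set of extreme
  points of \<open>S\<close>. Thus \<open>V \<subseteq> f ` V\<close>, and as \<open>V\<close> is finite, \<open>f\<close> permutes it. The average of \<open>V\<close> is then
  fixed.
\<close>

lemma affine_self_map_polytope_fixed_point:
  fixes S :: "'a::euclidean_space set"
  assumes "polytope S" "S \<noteq> {}" and f: "affine_map_on S f" and fS: "f ` S = S"
  shows "\<exists>p\<in>S. f p = p"
proof -
  define V where "V = {v. v extreme_point_of S}"
  have "finite V"
    using assms(1) extreme_points_of_convex_hull finite_subset
    unfolding V_def polytope_def by metis
  have S: "S = convex hull V"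
    using assms(1) Krein_Milman_polytope unfolding V_def polytope_def by metis
  have "V \<noteq> {}"
    using S \<open>S \<noteq> {}\<close> by auto
  have "convex S"
    using S by simp
  have VS: "V \<subseteq> S"
    by (simp add: S hull_subset)
  note comb = affine_map_on_convex_combination[OF f \<open>convex S\<close> \<open>finite V\<close>]
  have "f ` S \<subseteq> convex hull (f ` V)"
  proof clarify
    fix y assume "y \<in> S"
    then obtain u where u: "\<forall>v\<in>V. 0 \<le> u v" "sum u V = 1" and y: "(\<Sum>v\<in>V. u v *\<^sub>R v) = y"
      using convex_hull_finite[OF \<open>finite V\<close>] S by auto
    have "f y = (\<Sum>v\<in>V. u v *\<^sub>R f v)"
      using comb[of u "\<lambda>v. v"] u y VS by auto
    also have "\<dots> \<in> convex hull (f ` V)"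
      by (rule convex_sum) (use u \<open>finite V\<close> in \<open>auto intro: hull_inc\<close>)
    finally show "f y \<in> convex hull (f ` V)" .
  qed
  moreover have "convex hull (f ` V) \<subseteq> S"
    by (rule hull_minimal) (use VS fS \<open>convex S\<close> in auto)
  ultimately have "S = convex hull (f ` V)"
    using fS by auto
  then have "V \<subseteq> f ` V"
    using extreme_points_of_convex_hull V_def by metis
  moreover have "card (f ` V) \<le> card V"
    using \<open>finite V\<close> by (rule card_image_le)
  ultimately have fV: "f ` V = V"
    using \<open>finite V\<close> by (metis card_seteq finite_imageI)
  then have inj: "inj_on f V"
    using \<open>finite V\<close> by (simp add: eq_card_imp_inj_on)
  define w where "w = 1 / real (card V)"
  have w: "0 \<le> w" "(\<Sum>v\<in>V. w) = 1"
    using \<open>finite V\<close> \<open>V \<noteq> {}\<close> by (auto simp: w_def)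
  define p where "p = (\<Sum>v\<in>V. w *\<^sub>R v)"
  have "f p = (\<Sum>v\<in>V. w *\<^sub>R f v)"
    unfolding p_def using comb[of "\<lambda>_. w" "\<lambda>v. v"] w VS by auto
  also have "\<dots> = (\<Sum>v\<in>f ` V. w *\<^sub>R v)"
    by (simp add: sum.reindex[OF inj])
  also have "\<dots> = p"
    by (simp add: fV p_def)
  finally have "f p = p" .
  moreover have "p \<in> S"
    unfolding p_def by (rule convex_sum) (use \<open>finite V\<close> \<open>convex S\<close> w VS in auto)
  ultimately show ?thesis by blast
qed

section \<open>Volume of small neighbourhoods of low-dimensional polytopes\<close>

text \<open>
  Rounding the barycentric coordinates of \<open>x\<close> with respect to \<open>V\<close> down to multiples of \<open>1 / N\<close> moves
  \<open>x\<close> only by \<open>O(1 / N)\<close>. The coordinate of \<open>a\<close> is determined by the others, so only \<open>card V\<close>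
  directions \<open>v - a\<close> count; this is what gives the right exponent in the volume bound below.
\<close>

lemma convex_hull_insert_covered_by_grid:
  fixes V :: "'a::euclidean_space set"
  assumes "finite V" "N \<ge> 1" and x: "x \<in> convex hull (insert a V)"
  shows "\<exists>j \<in> V \<rightarrow>\<^sub>E {..N}. dist x (a + (\<Sum>v\<in>V. (real (j v) / real N) *\<^sub>R (v - a)))
           \<le> (\<Sum>v\<in>V. norm (v - a)) / real N"
proof -
  obtain t u where t: "0 \<le> t" and u: "\<And>v. v \<in> V \<Longrightarrow> 0 \<le> u v" and sum_u: "sum u V = 1 - t"
    and comb: "(\<Sum>v\<in>V. u v *\<^sub>R v) = x - t *\<^sub>R a"
    using x \<open>finite V\<close> convex_hull_finite_step[OF \<open>finite V\<close>, of a 1 x]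
    by (auto simp: convex_hull_finite)
  have "(\<Sum>v\<in>V. u v *\<^sub>R (v - a)) = (x - t *\<^sub>R a) - (1 - t) *\<^sub>R a"
    by (simp add: scaleR_right_diff_distrib sum_subtractf comb sum_u flip: scaleR_sum_left)
  then have x_eq: "x = a + (\<Sum>v\<in>V. u v *\<^sub>R (v - a))"
    by (simp add: algebra_simps)
  define j where "j = (\<lambda>v\<in>V. nat \<lfloor>real N * u v\<rfloor>)"
  have u1: "u v \<le> 1" if "v \<in> V" for v
    using member_le_sum[of v V u] u t sum_u that \<open>finite V\<close> by auto
  have j: "j \<in> V \<rightarrow>\<^sub>E {..N}"
  proof (rule PiE_I)
    fix v assume v: "v \<in> V"
    have "real N * u v \<le> real N"
      using u1[OF v] by (simp add: mult_left_le)
    then show "j v \<in> {..N}"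
      using v by (simp add: j_def nat_le_iff floor_le_iff)
  qed (simp add: j_def)
  have err: "\<bar>u v - real (j v) / real N\<bar> \<le> 1 / real N" if v: "v \<in> V" for v
  proof -
    have "0 \<le> real N * u v"
      using u[OF v] by simp
    then have "\<bar>real N * u v - real (j v)\<bar> \<le> 1"
      using v by (simp add: j_def) linarith
    then have "\<bar>real N * u v - real (j v)\<bar> / real N \<le> 1 / real N"
      by (rule divide_right_mono) simp
    moreover have "u v - real (j v) / real N = (real N * u v - real (j v)) / real N"
      using \<open>N \<ge> 1\<close> by (simp add: field_simps)
    ultimately show ?thesis
      by (simp add: abs_divide)
  qed
  have "dist x (a + (\<Sum>v\<in>V. (real (j v) / real N) *\<^sub>R (v - a)))
      = norm (\<Sum>v\<in>V. (u v - real (j v) / real N) *\<^sub>R (v - a))"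
    by (simp add: x_eq dist_norm scaleR_left_diff_distrib sum_subtractf)
  also have "\<dots> \<le> (\<Sum>v\<in>V. (1 / real N) * norm (v - a))"
    by (rule sum_norm_le) (use err in \<open>simp only: norm_scaleR\<close>, intro mult_right_mono, auto)
  also have "\<dots> = (\<Sum>v\<in>V. norm (v - a)) / real N"
    by (simp add: sum_divide_distrib)
  finally show ?thesis
    using j by blast
qed

text \<open>
  With \<open>d = card V\<close>, the \<open>(N + 1) ^ d\<close> grid points, each surrounded by a ball of radius \<open>M / N\<close>, cover
  the neighbourhood. Their total volume is of order \<open>N ^ d * (1 / N) ^ n\<close>.
\<close>

lemma measure_neighbourhood_convex_hull_le:
  fixes V :: "'a::euclidean_space set"
  assumes "finite V" "card V \<le> DIM('a)"
  shows "\<exists>K. \<forall>N\<ge>1. measure lebesgue {y. infdist y (convex hull (insert a V)) \<le> 1 / real N}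
           \<le> K * (1 / real N) ^ (DIM('a) - card V)"
proof (intro exI allI impI)
  let ?A = "convex hull (insert a V)" and ?n = "DIM('a)" and ?d = "card V"
  \<comment> \<open>Rounding to the grid costs \<open>(M - 1) / N\<close>, the width of the neighbourhood \<open>1 / N\<close>.\<close>
  define M where "M = (\<Sum>v\<in>V. norm (v - a)) + 1"
  define B where "B = unit_ball_vol (real ?n)"
  have "M \<ge> 0" "B \<ge> 0"
    by (auto simp: M_def B_def intro!: add_nonneg_nonneg sum_nonneg)
  fix N :: nat
  assume "N \<ge> 1"
  define c where "c j = a + (\<Sum>v\<in>V. (real (j v) / real N) *\<^sub>R (v - a))" for j :: "'a \<Rightarrow> nat"
  let ?J = "V \<rightarrow>\<^sub>E {..N}"
  have "finite ?J"
    using \<open>finite V\<close> by (simp add: finite_PiE)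
  have cover: "{y. infdist y ?A \<le> 1 / real N} \<subseteq> (\<Union>j\<in>?J. cball (c j) (M / real N))"
  proof clarify
    fix y assume y: "infdist y ?A \<le> 1 / real N"
    have "compact ?A"
      using \<open>finite V\<close> by (simp add: finite_imp_compact_convex_hull)
    then obtain x where x: "x \<in> ?A" "infdist y ?A = dist y x"
      using infdist_attains_inf[of ?A y] compact_imp_closed by auto
    obtain j where j: "j \<in> ?J" "dist x (c j) \<le> (\<Sum>v\<in>V. norm (v - a)) / real N"
      using convex_hull_insert_covered_by_grid[OF \<open>finite V\<close> \<open>N \<ge> 1\<close> x(1)] by (auto simp: c_def)
    have "dist y (c j) \<le> dist y x + dist x (c j)"
      by (rule dist_triangle)
    also have "\<dots> \<le> M / real N"
      using x y j by (simp add: M_def add_divide_distrib)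
    finally show "y \<in> (\<Union>j\<in>?J. cball (c j) (M / real N))"
      using j(1) by (auto simp: dist_commute)
  qed
  have "{y. infdist y ?A \<le> 1 / real N} \<in> lmeasurable"
    using \<open>finite V\<close> \<open>N \<ge> 1\<close>
    by (intro lmeasurable_compact compact_infdist_le finite_imp_compact_convex_hull) auto
  then have "measure lebesgue {y. infdist y ?A \<le> 1 / real N}
      \<le> measure lebesgue (\<Union>j\<in>?J. cball (c j) (M / real N))"
    using cover \<open>finite ?J\<close>
    by (intro measure_mono_fmeasurable fmeasurable.finite_UN fmeasurableD) auto
  also have "\<dots> \<le> (\<Sum>j\<in>?J. measure lebesgue (cball (c j) (M / real N)))"
    using \<open>finite ?J\<close> by (intro measure_UNION_le) auto
  also have "\<dots> = real (card ?J) * (B * (M / real N) ^ ?n)"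
    using \<open>M \<ge> 0\<close> by (simp add: content_cball B_def)
  also have "card ?J = (N + 1) ^ ?d"
    using \<open>finite V\<close> by (simp add: card_PiE)
  also have "real ((N + 1) ^ ?d) * (B * (M / real N) ^ ?n)
      \<le> (2 * real N) ^ ?d * (B * (M / real N) ^ ?n)"
  proof (rule mult_right_mono)
    have "real (N + 1) \<le> 2 * real N"
      using \<open>N \<ge> 1\<close> by simp
    then show "real ((N + 1) ^ ?d) \<le> (2 * real N) ^ ?d"
      unfolding of_nat_power by (rule power_mono) simp
  qed (use \<open>M \<ge> 0\<close> \<open>B \<ge> 0\<close> in simp)
  also have "\<dots> = 2 ^ ?d * B * M ^ ?n * (1 / real N) ^ (?n - ?d)"
  proof -
    have "real N ^ ?n = real N ^ ?d * real N ^ (?n - ?d)"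
      using assms(2) by (simp flip: power_add)
    then show ?thesis
      using \<open>N \<ge> 1\<close> by (simp add: power_mult_distrib power_divide)
  qed
  finally show "measure lebesgue {y. infdist y ?A \<le> 1 / real N}
      \<le> 2 ^ ?d * B * M ^ ?n * (1 / real N) ^ (?n - ?d)" .
qed

section \<open>Vanishing of intrinsic volumes above the dimension\<close>

text \<open>
  The bound along the sequence \<open>1 / N\<close> forces \<open>p\<close> to vanish at \<open>0\<close>; dividing \<open>p\<close> by the variable
  lowers \<open>m\<close> by one.
\<close>

lemma coeff_eq_0_if_poly_small_at_0:
  fixes p :: "real poly"
  assumes "\<And>N::nat. N \<ge> 1 \<Longrightarrow> \<bar>poly p (1 / real N)\<bar> \<le> K * (1 / real N) ^ m" and "i < m"
  shows "coeff p i = 0"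
  using assms
proof (induction m arbitrary: p i)
  case (Suc m)
  have lim: "(\<lambda>N. 1 / real N) \<longlonglongrightarrow> 0"
    by (rule lim_1_over_n)
  have "(\<lambda>N. poly p (1 / real N)) \<longlonglongrightarrow> 0"
  proof (rule Lim_null_comparison)
    show "\<forall>\<^sub>F N in sequentially. norm (poly p (1 / real N)) \<le> K * (1 / real N) ^ Suc m"
      using Suc.prems(1) by (auto simp: eventually_sequentially)
    show "(\<lambda>N. K * (1 / real N) ^ Suc m) \<longlonglongrightarrow> 0"
      using tendsto_mult[OF tendsto_const tendsto_power[OF lim, of "Suc m"], of K] by simp
  qed
  moreover have "(\<lambda>N. poly p (1 / real N)) \<longlonglongrightarrow> poly p 0"
    using lim by (rule tendsto_poly)
  ultimately have "poly p 0 = 0"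
    using LIMSEQ_unique by blast
  then obtain q where p: "p = pCons 0 q"
    by (metis pCons_cases poly_pCons mult_zero_left add.right_neutral)
  have "\<bar>poly q (1 / real N)\<bar> \<le> K * (1 / real N) ^ m" if "N \<ge> 1" for N :: nat
    using Suc.prems(1)[OF that] that by (simp add: p abs_mult field_simps)
  then have "coeff q j = 0" if "j < m" for j
    using Suc.IH that by blast
  then show ?case
    using Suc.prems(2) by (auto simp: p coeff_pCons split: nat.split)
qed simp

text \<open>
  The dimension of \<open>convex hull V\<close> is at most \<open>card V - 1\<close>, with equality for a simplex with vertex set
  \<open>V\<close>; so \<open>card V \<le> k\<close> puts \<open>k\<close> above the dimension.
\<close>

lemma intrinsic_volume_eq_0_above_dim:
  fixes V :: "'a::euclidean_space set"
  assumes "finite V" "V \<noteq> {}" "card V \<le> k" "k \<le> DIM('a)"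
  shows "intrinsic_volume k (convex hull V) = 0"
proof (cases "\<exists>\<mu>. steiner_coeffs (convex hull V) \<mu>")
  case True
  then obtain \<mu> where \<mu>: "steiner_coeffs (convex hull V) \<mu>" ..
  let ?n = "DIM('a)"
  obtain a W where V: "V = insert a W" "a \<notin> W"
    using \<open>V \<noteq> {}\<close> by (metis all_not_in_conv mk_disjoint_insert)
  have W: "finite W" "card W < k"
    using assms V by auto
  \<comment> \<open>\<open>p\<close> is the Steiner polynomial, rewritten in ascending powers of \<open>\<rho>\<close>.\<close>
  define c where "c i = unit_ball_vol (real i) * \<mu> (?n - i)" for i
  define p where "p = (\<Sum>i\<le>?n. monom (c i) i)"
  have vol: "measure lebesgue {y. infdist y (convex hull V) \<le> \<rho>} = poly p \<rho>" if "\<rho> > 0" for \<rho>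
  proof -
    have "measure lebesgue {y. infdist y (convex hull V) \<le> \<rho>}
        = (\<Sum>j\<le>?n. \<rho> ^ (?n - j) * unit_ball_vol (real (?n - j)) * \<mu> j)"
      using \<mu> that by (simp add: steiner_coeffs_def)
    also have "\<dots> = (\<Sum>i\<le>?n. c i * \<rho> ^ i)"
      by (rule sum.reindex_bij_witness[of _ "\<lambda>i. ?n - i" "\<lambda>i. ?n - i"]) (auto simp: c_def)
    finally show ?thesis
      by (simp add: p_def poly_sum poly_monom)
  qed
  obtain K where K: "\<And>N::nat. N \<ge> 1 \<Longrightarrow>
      measure lebesgue {y. infdist y (convex hull V) \<le> 1 / real N} \<le> K * (1 / real N) ^ (?n - card W)"
    using measure_neighbourhood_convex_hull_le[of W a] W assms(4) V by auto
  have "coeff p (?n - k) = 0"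
  proof (rule coeff_eq_0_if_poly_small_at_0)
    show "\<bar>poly p (1 / real N)\<bar> \<le> K * (1 / real N) ^ (?n - card W)" if "N \<ge> 1" for N :: nat
    proof -
      have "0 < 1 / real N"
        using that by simp
      then show ?thesis
        using K[OF that] by (simp flip: vol)
    qed
    show "?n - k < ?n - card W"
      using W assms(4) by linarith
  qed
  moreover have "coeff p (?n - k) = unit_ball_vol (real (?n - k)) * \<mu> k"
    using assms(4) by (simp add: p_def c_def coeff_sum coeff_monom)
  moreover have "unit_ball_vol (real (?n - k)) \<noteq> 0"
    using unit_ball_vol_pos[of "real (?n - k)"] by linarith
  ultimately show ?thesis
    using intrinsic_volume_eq[OF \<mu> assms(4)] by auto
qed (simp add: intrinsic_volume_def)

section \<open>Nonzero Lefschetz volume forces a fixed point\<close>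

theorem theorem8:
  fixes C :: "(real ^ 'n) set set" and f :: "real ^ 'n \<Rightarrow> real ^ 'n" and k :: nat
  assumes "simplicial_complex C"
    and "simplicial_map C C f"
    and "k \<le> CARD('n)"
    and "lefschetz_volume k f C \<noteq> 0"
  shows "\<exists>x\<in>C. aff_dim x \<ge> int k \<and> (\<exists>p\<in>x. f p = p)"
proof -
  obtain x where x: "x \<in> C" "x \<noteq> {}"
    and coeff: "orientation_coeff f x \<noteq> 0" and vol: "intrinsic_volume k x \<noteq> 0"
  proof -
    obtain x where "x \<in> C - {{}}" "(- 1) powi (aff_dim x - int k) * of_int (orientation_coeff f x) *
        intrinsic_volume k x \<noteq> 0"
      using assms(4) unfolding lefschetz_volume_def by (rule sum.not_neutral_contains_not_neutral)
    then show ?thesis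
      using that by auto
  qed
  obtain V where V: "\<not> affine_dependent V" "x = convex hull V"
    using assms(1) x(1) unfolding simplicial_complex_def simplex_def by blast
  then have "finite V"
    using aff_independent_finite by blast
  have "aff_dim x = int (card V) - 1"
    using aff_dim_affine_independent[OF V(1)] by (simp add: V(2) aff_dim_convex_hull)
  moreover have "k < card V"
    using intrinsic_volume_eq_0_above_dim[OF \<open>finite V\<close>, of k] vol x(2) assms(3)
    by (cases "card V \<le> k") (auto simp: V(2))
  ultimately have "aff_dim x \<ge> int k"
    by linarith
  moreover have "f ` x = x"
    using coeff by (simp add: orientation_coeff_def split: if_splits)
  then have "\<exists>p\<in>x. f p = p"
  proof (rule affine_self_map_polytope_fixed_point[rotated 3])
    show "polytope x"
      using V(2) \<open>finite V\<close> by (auto simp: polytope_def)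
    show "affine_map_on x f"
      using assms(2) x(1) by (simp add: simplicial_map_def)
  qed (fact x(2))
  ultimately show ?thesis
    using x(1) by blast
qed

end
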